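(* Let $c$ be a hereditary property of graphs and let $p$ be any permutation (pattern). Define \[ \mathcal{G}_{p,c} = \{\pi \in \mathfrak{S} : G_p(\pi) \text{ has property } c\}. \] Then $\mathcal{G}_{p,c}$ is a permutation class, i.e., there is a set $M$ of (classical) permutation patterns such that $\mathcal{G}_{p,c} = \mathrm{Av}(M)$.
   Context: A permutation of length $n$ is a bijection $\pi:\{1,\dots,n\}\to\{1,\dots,n\}$, written $\pi(1)\cdots\pi(n)$; $\mathfrak{S}$ is the set of all permutations of all lengths $n\ge 0$ (including the empty permutation). For a permutation $p$ of length $k$ and a permutation $\pi$ of length $n$, an index set of $p$ in $\pi$ is a set $\{i_1<\dots<i_k\}\subseteq\{1,\dots,n\}$ such that $\pi(i_1)\cdots\pi(i_k)$ is order-isomorphic to $p$ (i.e., $\pi(i_a)<\pi(i_b)$ iff $p(a)<p(b)$). The occurrence set $V_p(\pi)$ is the set of all index sets of $p$ in $\pi$. The permutation $\pi$ contains $p$ if $V_p(\pi)\neq\emptyset$ and avoids $p$ otherwise; for a set $M$ of permutations, $\mathrm{Av}(M)$ is the set of permutations avoiding every element of $M$. The occurrence graph $G_p(\pi)$ is the simple undirected graph with vertex set $V_p(\pi)$ in which $u,v$ are adjacent iff $|u\setminus v|=|v\setminus u|=1$. A subgraph of a graph $G=(V,E)$ is a graph $(V',E')$ with $V'\subseteq V$ and $E'\subseteq\{\{u,v\}\in E: u,v\in V'\}$. A property of graphs is hereditary if it is invariant under graph isomorphism and, whenever a graph has the property, every subgraph of it also has the property. *)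

theory Defs
  imports Main "HOL-Combinatorics.Permutations"
begin

text \<open>A permutation of length \<open>n\<close> is a pair \<open>(n, f)\<close> with \<open>f permutes {1..n}\<close>. Since \<open>f permutes A\<close>
  forces \<open>f\<close> to be the identity outside \<open>A\<close>, each bijection of \<open>{1..n}\<close> is represented exactly once.\<close>

type_synonym perm = "nat \<times> (nat \<Rightarrow> nat)"

definition perms :: "perm set" where
  "perms = {(n, f). f permutes {1..n}}"

definition index_set :: "perm \<Rightarrow> perm \<Rightarrow> nat set \<Rightarrow> bool" where
  "index_set p \<pi> I \<longleftrightarrow> I \<subseteq> {1..fst \<pi>} \<and>
     (\<exists>i. strict_mono_on {1..fst p} i \<and> I = i ` {1..fst p} \<and>
        (\<forall>a\<in>{1..fst p}. \<forall>b\<in>{1..fst p}. snd \<pi> (i a) < snd \<pi> (i b) \<longleftrightarrow> snd p a < snd p b))"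

definition occurrence_set :: "perm \<Rightarrow> perm \<Rightarrow> nat set set" where
  "occurrence_set p \<pi> = {I. index_set p \<pi> I}"

definition contains :: "perm \<Rightarrow> perm \<Rightarrow> bool" where
  "contains \<pi> p \<longleftrightarrow> occurrence_set p \<pi> \<noteq> {}"

definition avoids :: "perm \<Rightarrow> perm \<Rightarrow> bool" where
  "avoids \<pi> p \<longleftrightarrow> \<not> contains \<pi> p"

definition Av :: "perm set \<Rightarrow> perm set" where
  "Av M = {\<pi> \<in> perms. \<forall>p\<in>M. avoids \<pi> p}"

definition permutation_class :: "perm set \<Rightarrow> bool" where
  "permutation_class C \<longleftrightarrow> (\<exists>M. M \<subseteq> perms \<and> C = Av M)"

type_synonym 'a ugraph = "'a set \<times> 'a set set"

definition simple_graph :: "'a ugraph \<Rightarrow> bool" where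
  "simple_graph G \<longleftrightarrow> (\<forall>e\<in>snd G. \<exists>u\<in>fst G. \<exists>v\<in>fst G. u \<noteq> v \<and> e = {u, v})"

definition subgraph_of :: "'a ugraph \<Rightarrow> 'a ugraph \<Rightarrow> bool" where
  "subgraph_of H G \<longleftrightarrow> fst H \<subseteq> fst G \<and>
     snd H \<subseteq> {{u, v} | u v. {u, v} \<in> snd G \<and> u \<in> fst H \<and> v \<in> fst H}"

definition graph_iso :: "'a ugraph \<Rightarrow> 'a ugraph \<Rightarrow> bool" where
  "graph_iso G H \<longleftrightarrow> (\<exists>f. bij_betw f (fst G) (fst H) \<and>
     (\<forall>u\<in>fst G. \<forall>v\<in>fst G. {u, v} \<in> snd G \<longleftrightarrow> {f u, f v} \<in> snd H))"

definition hereditary :: "('a ugraph \<Rightarrow> bool) \<Rightarrow> bool" where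
  "hereditary c \<longleftrightarrow>
     (\<forall>G H. simple_graph G \<longrightarrow> simple_graph H \<longrightarrow> graph_iso G H \<longrightarrow> (c G \<longleftrightarrow> c H)) \<and>
     (\<forall>G H. simple_graph G \<longrightarrow> c G \<longrightarrow> subgraph_of H G \<longrightarrow> c H)"

definition occurrence_graph :: "perm \<Rightarrow> perm \<Rightarrow> nat set ugraph" where
  "occurrence_graph p \<pi> =
     (occurrence_set p \<pi>,
      {{u, v} | u v. u \<in> occurrence_set p \<pi> \<and> v \<in> occurrence_set p \<pi> \<and>
         card (u - v) = 1 \<and> card (v - u) = 1})"

definition graph_class :: "perm \<Rightarrow> (nat set ugraph \<Rightarrow> bool) \<Rightarrow> perm set" where
  "graph_class p c = {\<pi> \<in> perms. c (occurrence_graph p \<pi>)}"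

lemma simple_graph_subgraph_of:
  assumes "simple_graph G" "subgraph_of H G"
  shows "simple_graph H"
  unfolding simple_graph_def
proof
  fix e assume "e \<in> snd H"
  then obtain u v where uv: "e = {u, v}" "{u, v} \<in> snd G" "u \<in> fst H" "v \<in> fst H"
    using assms(2) unfolding subgraph_of_def by blast
  moreover have "u \<noteq> v"
    using assms(1) uv(2) unfolding simple_graph_def by (auto simp: doubleton_eq_iff)
  ultimately show "\<exists>u\<in>fst H. \<exists>v\<in>fst H. u \<noteq> v \<and> e = {u, v}" by blast
qed

lemma simple_graph_occurrence_graph: "simple_graph (occurrence_graph p \<pi>)"
  unfolding simple_graph_def
proof
  fix e assume "e \<in> snd (occurrence_graph p \<pi>)"
  then obtain u v where uv: "e = {u, v}" "u \<in> occurrence_set p \<pi>" "v \<in> occurrence_set p \<pi>"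
    "card (u - v) = 1"
    unfolding occurrence_graph_def snd_conv by blast
  moreover from uv(4) have "u \<noteq> v" by auto
  ultimately show "\<exists>u\<in>fst (occurrence_graph p \<pi>). \<exists>v\<in>fst (occurrence_graph p \<pi>). u \<noteq> v \<and> e = {u, v}"
    unfolding occurrence_graph_def fst_conv by blast
qed

end

theory Submission imports Defs begin

text \<open>An occurrence of \<open>\<sigma>\<close> in \<open>\<pi>\<close>, viewed as a strictly increasing map of positions, carries
  occurrences of \<open>p\<close> in \<open>\<sigma>\<close> injectively to occurrences of \<open>p\<close> in \<open>\<pi>\<close> and preserves the sizes of
  set differences. So the occurrence graph of \<open>\<sigma>\<close> is isomorphic to a subgraph of that of \<open>\<pi>\<close>,
  \<open>graph_class p c\<close> is closed under containment, and its complement serves as the set of forbidden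
  patterns.\<close>

text \<open>Edges are subsets of the vertex set, and taking images under \<open>f\<close> is
  injective on such subsets. Hence no non-edge can be sent to the image of an edge.\<close>

lemma graph_iso_image:
  assumes "simple_graph G" "inj_on f (fst G)"
  shows "graph_iso G (f ` fst G, (`) f ` snd G)"
proof -
  have "snd G \<subseteq> Pow (fst G)"
    using assms(1) unfolding simple_graph_def by fastforce
  then have "{f u, f v} \<in> (`) f ` snd G \<longleftrightarrow> {u, v} \<in> snd G" if "u \<in> fst G" "v \<in> fst G" for u v
    using inj_on_image_mem_iff[OF inj_on_image_Pow[OF assms(2)], of "{u, v}" "snd G"] that by simp
  with assms(2) show ?thesis
    unfolding graph_iso_def by (intro exI[of _ f]) (simp add: bij_betw_def)
qed

text \<open>Needed because \<open>hereditary\<close> grants invariance under isomorphism only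
  between simple graphs.\<close>

lemma simple_graph_image:
  assumes "simple_graph G" "inj_on f (fst G)"
  shows "simple_graph (f ` fst G, (`) f ` snd G)"
  unfolding simple_graph_def
proof
  fix e assume "e \<in> snd (f ` fst G, (`) f ` snd G)"
  then obtain d where d: "d \<in> snd G" "e = f ` d" by auto
  then obtain u v where "u \<in> fst G" "v \<in> fst G" "u \<noteq> v" "d = {u, v}"
    using assms(1) unfolding simple_graph_def by blast
  then have "f u \<in> f ` fst G" "f v \<in> f ` fst G" "f u \<noteq> f v" "e = {f u, f v}"
    using d assms(2) by (auto dest: inj_onD)
  then show "\<exists>u\<in>fst (f ` fst G, (`) f ` snd G). \<exists>v\<in>fst (f ` fst G, (`) f ` snd G).
      u \<noteq> v \<and> e = {u, v}"
    unfolding fst_conv by blast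
qed

text \<open>The property descends from \<open>G\<close> to the relabelled copy of \<open>H\<close>
  by closure under subgraphs, then returns to \<open>H\<close> itself by invariance under
  isomorphism.\<close>

lemma hereditary_embedding:
  assumes "hereditary c" "simple_graph G" "simple_graph H" "c G"
    and "inj_on f (fst H)" "subgraph_of (f ` fst H, (`) f ` snd H) G"
  shows "c H"
proof -
  let ?K = "(f ` fst H, (`) f ` snd H)"
  have "c ?K"
    using assms(1,2,4,6) unfolding hereditary_def by meson
  then show ?thesis
    using assms(1,3) graph_iso_image[OF assms(3,5)] simple_graph_image[OF assms(3,5)]
    unfolding hereditary_def by meson
qed

text \<open>Composing the increasing map that witnesses \<sigma> in \<pi> with the one that
  witnesses \<open>p\<close> in \<sigma> gives a witness of \<open>p\<close> in \<pi>.\<close>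

lemma index_set_image:
  assumes i: "strict_mono_on {1..fst \<sigma>} i" "i ` {1..fst \<sigma>} \<subseteq> {1..fst \<pi>}"
    and ord: "\<forall>a\<in>{1..fst \<sigma>}. \<forall>b\<in>{1..fst \<sigma>}.
      snd \<pi> (i a) < snd \<pi> (i b) \<longleftrightarrow> snd \<sigma> a < snd \<sigma> b"
    and I: "index_set p \<sigma> I"
  shows "index_set p \<pi> (i ` I)"
proof -
  obtain j where j: "I \<subseteq> {1..fst \<sigma>}" "strict_mono_on {1..fst p} j" "I = j ` {1..fst p}"
    "\<forall>a\<in>{1..fst p}. \<forall>b\<in>{1..fst p}. snd \<sigma> (j a) < snd \<sigma> (j b) \<longleftrightarrow> snd p a < snd p b"
    using I unfolding index_set_def by blast
  have mem: "j a \<in> {1..fst \<sigma>}" if "a \<in> {1..fst p}" for a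
    using j(1,3) that by blast
  have "strict_mono_on {1..fst p} (i \<circ> j)"
    using i(1) j(2) mem unfolding strict_mono_on_def comp_def by blast
  moreover have "i ` I = (i \<circ> j) ` {1..fst p}"
    using j(3) by (simp add: image_comp)
  moreover have "snd \<pi> ((i \<circ> j) a) < snd \<pi> ((i \<circ> j) b) \<longleftrightarrow> snd p a < snd p b"
    if "a \<in> {1..fst p}" "b \<in> {1..fst p}" for a b
    using ord j(4) mem that by simp
  moreover have "i ` I \<subseteq> {1..fst \<pi>}"
    using i(2) j(1) by blast
  ultimately show ?thesis
    unfolding index_set_def by blast
qed

lemma occurrence_graph_contains:
  assumes "contains \<pi> \<sigma>"
  obtains f where "inj_on f (fst (occurrence_graph p \<sigma>))"
    and "subgraph_of (f ` fst (occurrence_graph p \<sigma>), (`) f ` snd (occurrence_graph p \<sigma>))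
      (occurrence_graph p \<pi>)"
proof -
  obtain i where i: "strict_mono_on {1..fst \<sigma>} i" "i ` {1..fst \<sigma>} \<subseteq> {1..fst \<pi>}"
    "\<forall>a\<in>{1..fst \<sigma>}. \<forall>b\<in>{1..fst \<sigma>}. snd \<pi> (i a) < snd \<pi> (i b) \<longleftrightarrow> snd \<sigma> a < snd \<sigma> b"
    using assms unfolding contains_def occurrence_set_def index_set_def by auto
  have inj: "inj_on i {1..fst \<sigma>}"
    using i(1) by (rule strict_mono_on_imp_inj_on)
  \<comment> \<open>This confines all occurrences to the domain where \<open>i\<close> is known to
    be injective.\<close>
  have sub: "occurrence_set p \<sigma> \<subseteq> Pow {1..fst \<sigma>}"
    unfolding occurrence_set_def index_set_def by blast
  have occ: "i ` u \<in> occurrence_set p \<pi>" if "u \<in> occurrence_set p \<sigma>" for u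
    using index_set_image[OF i] that unfolding occurrence_set_def by blast
  \<comment> \<open>Adjacency depends only on these cardinalities, and an injective map commutes
    with set difference, so edges go to edges.\<close>
  have card: "card (i ` u - i ` v) = card (u - v)"
    if "u \<in> occurrence_set p \<sigma>" "v \<in> occurrence_set p \<sigma>" for u v
  proof -
    have uv: "u - v \<subseteq> {1..fst \<sigma>}" "v \<subseteq> {1..fst \<sigma>}"
      using that sub by blast+
    have "i ` u - i ` v = i ` (u - v)"
      using inj_on_image_set_diff[OF inj uv] by simp
    then show ?thesis
      using card_image[OF inj_on_subset[OF inj uv(1)]] by simp
  qed
  show thesis
  proof
    show "inj_on ((`) i) (fst (occurrence_graph p \<sigma>))"
      using inj_on_subset[OF inj_on_image_Pow[OF inj] sub] by (simp add: occurrence_graph_def)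
    show "subgraph_of ((`) i ` fst (occurrence_graph p \<sigma>), (`) ((`) i) ` snd (occurrence_graph p \<sigma>))
      (occurrence_graph p \<pi>)"
      unfolding subgraph_of_def fst_conv snd_conv
    proof (intro conjI subsetI)
      fix w assume "w \<in> (`) i ` fst (occurrence_graph p \<sigma>)"
      then show "w \<in> fst (occurrence_graph p \<pi>)"
        using occ unfolding occurrence_graph_def by auto
    next
      fix e assume "e \<in> (`) ((`) i) ` snd (occurrence_graph p \<sigma>)"
      then obtain u v where uv: "e = {i ` u, i ` v}" "u \<in> occurrence_set p \<sigma>"
        "v \<in> occurrence_set p \<sigma>" "card (u - v) = 1" "card (v - u) = 1"
        unfolding occurrence_graph_def by auto
      have "i ` u \<in> occurrence_set p \<pi>" "i ` v \<in> occurrence_set p \<pi>"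
        "card (i ` u - i ` v) = 1" "card (i ` v - i ` u) = 1"
        using uv occ card by simp_all
      then have "{i ` u, i ` v} \<in> snd (occurrence_graph p \<pi>)"
        unfolding occurrence_graph_def snd_conv by blast
      moreover have "i ` u \<in> (`) i ` fst (occurrence_graph p \<sigma>)"
        "i ` v \<in> (`) i ` fst (occurrence_graph p \<sigma>)"
        using uv(2,3) unfolding occurrence_graph_def by auto
      ultimately show "e \<in> {{x, y} | x y. {x, y} \<in> snd (occurrence_graph p \<pi>) \<and>
          x \<in> (`) i ` fst (occurrence_graph p \<sigma>) \<and> y \<in> (`) i ` fst (occurrence_graph p \<sigma>)}"
        using uv(1) by blast
    qed
  qed
qed

lemma contains_refl: "contains \<pi> \<pi>"
proof -
  have "index_set \<pi> \<pi> {1..fst \<pi>}"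
    unfolding index_set_def by (intro conjI exI[of _ id]) (auto simp: strict_mono_on_def)
  then show ?thesis
    unfolding contains_def occurrence_set_def by blast
qed

text \<open>The forbidden set is the entire complement of \<open>C\<close>, with no attempt at a
  minimal basis. A member of \<open>C\<close> avoids it by closure; a permutation outside
  \<open>C\<close> fails to avoid it because it contains itself.\<close>

lemma permutation_class_if_closed:
  assumes "C \<subseteq> perms"
    and "\<And>\<pi> \<sigma>. \<pi> \<in> C \<Longrightarrow> \<sigma> \<in> perms \<Longrightarrow> contains \<pi> \<sigma> \<Longrightarrow> \<sigma> \<in> C"
  shows "permutation_class C"
proof -
  have "C = Av (perms - C)"
    using assms contains_refl unfolding Av_def avoids_def by blast
  then show ?thesis
    unfolding permutation_class_def by blast
qed

theorem theorem5p3: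
  fixes c :: "nat set ugraph \<Rightarrow> bool" and p :: perm
  assumes "hereditary c" and "p \<in> perms"
  shows "permutation_class (graph_class p c)"
proof (rule permutation_class_if_closed)
  show "graph_class p c \<subseteq> perms"
    unfolding graph_class_def by blast
next
  fix \<pi> \<sigma> assume \<pi>: "\<pi> \<in> graph_class p c" and \<sigma>: "\<sigma> \<in> perms" and cont: "contains \<pi> \<sigma>"
  from cont obtain f where f: "inj_on f (fst (occurrence_graph p \<sigma>))"
    "subgraph_of (f ` fst (occurrence_graph p \<sigma>), (`) f ` snd (occurrence_graph p \<sigma>))
      (occurrence_graph p \<pi>)"
    by (rule occurrence_graph_contains)
  have "c (occurrence_graph p \<pi>)"
    using \<pi> unfolding graph_class_def by blast
  from hereditary_embedding[OF assms(1) simple_graph_occurrence_graph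
      simple_graph_occurrence_graph this f]
  show "\<sigma> \<in> graph_class p c"
    using \<sigma> unfolding graph_class_def by blast
qed

end
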